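(* The modal logic $8$f is strongly complete for the class of all non-degenerate elliptic $1$-planes: every $8$f-consistent set of modal formulas is satisfiable in some model on some non-degenerate elliptic $1$-plane.
   Context: Modal formulas are built from countably many propositional variables with $\neg,\wedge,\Box$; $\Diamond=\neg\Box\neg$. A $1$-frame is $(X,I)$ with $I\subseteq X\times X$; a model adds a valuation of variables as subsets of $X$, with $\Box\varphi$ true at $a$ iff $\varphi$ is true at all $b$ with $aIb$. A set is satisfiable in a model if all its members are true at some common point. A normal logic contains all tautologies and instances of $\Box(\varphi\to\psi)\to(\Box\varphi\to\Box\psi)$, closed under modus ponens and necessitation. $12$g is the smallest normal logic containing all instances of $\Box\varphi\to\Diamond\varphi$, $\Diamond\Box\varphi\to\varphi$, $\Box\Box\varphi\to\Box\Box\Box\Box\varphi$; $8$f is the smallest normal logic containing $12$g and all instances of $\Box\Box\Box\varphi\to\varphi$. A set $\Sigma$ is $\Lambda$-consistent if no finite conjunction $\varphi$ of its members has $\neg\varphi\in\Lambda$. With $I^2$ the composition of $I$ with itself, an elliptic $1$-plane is a $1$-frame satisfying O5: $aI^2b$ for all $a,b$, and O3: $aIbIcIdIa$ implies $a=c$ or $b=d$. It is non-degenerate if there exist $a,b,c,d$ with $aIbIcId$, $a\ne c$, $b\ne d$, and neither $aIc$ nor $bId$. *)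

theory Defs
  imports Main
begin

datatype form = Var nat | Neg form | Conj form form | Box form

abbreviation Imp :: "form \<Rightarrow> form \<Rightarrow> form" where
  "Imp \<phi> \<psi> \<equiv> Neg (Conj \<phi> (Neg \<psi>))"

abbreviation Dia :: "form \<Rightarrow> form" where
  "Dia \<phi> \<equiv> Neg (Box (Neg \<phi>))"

abbreviation Top :: form where
  "Top \<equiv> Neg (Conj (Var 0) (Neg (Var 0)))"

text \<open>
  Variables and boxed formulas are the atoms for propositional evaluation, so the tautologies
  below are exactly the substitution instances (by modal formulas) of propositional tautologies.
\<close>

primrec prop_eval :: "(form \<Rightarrow> bool) \<Rightarrow> form \<Rightarrow> bool" where
  "prop_eval v (Var p) \<longleftrightarrow> v (Var p)"
| "prop_eval v (Neg \<phi>) \<longleftrightarrow> \<not> prop_eval v \<phi>"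
| "prop_eval v (Conj \<phi> \<psi>) \<longleftrightarrow> prop_eval v \<phi> \<and> prop_eval v \<psi>"
| "prop_eval v (Box \<phi>) \<longleftrightarrow> v (Box \<phi>)"

definition tautology :: "form \<Rightarrow> bool" where
  "tautology \<phi> \<longleftrightarrow> (\<forall>v. prop_eval v \<phi>)"

definition normal_logic :: "form set \<Rightarrow> bool" where
  "normal_logic L \<longleftrightarrow>
     (\<forall>\<phi>. tautology \<phi> \<longrightarrow> \<phi> \<in> L) \<and>
     (\<forall>\<phi> \<psi>. Imp (Box (Imp \<phi> \<psi>)) (Imp (Box \<phi>) (Box \<psi>)) \<in> L) \<and>
     (\<forall>\<phi> \<psi>. Imp \<phi> \<psi> \<in> L \<longrightarrow> \<phi> \<in> L \<longrightarrow> \<psi> \<in> L) \<and>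
     (\<forall>\<phi>. \<phi> \<in> L \<longrightarrow> Box \<phi> \<in> L)"

definition logic_12g :: "form set" where
  "logic_12g = \<Inter> {L. normal_logic L \<and>
     (\<forall>\<phi>. Imp (Box \<phi>) (Dia \<phi>) \<in> L) \<and>
     (\<forall>\<phi>. Imp (Dia (Box \<phi>)) \<phi> \<in> L) \<and>
     (\<forall>\<phi>. Imp (Box (Box \<phi>)) (Box (Box (Box (Box \<phi>)))) \<in> L)}"

definition logic_8f :: "form set" where
  "logic_8f = \<Inter> {L. normal_logic L \<and> logic_12g \<subseteq> L \<and>
     (\<forall>\<phi>. Imp (Box (Box (Box \<phi>))) \<phi> \<in> L)}"

text \<open>
  The trailing \<^const>\<open>Top\<close> makes the empty conjunction meaningful; up to tautological
  equivalence it does not affect the other ones.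
\<close>

definition big_conj :: "form list \<Rightarrow> form" where
  "big_conj \<phi>s = foldr Conj \<phi>s Top"

definition consistent :: "form set \<Rightarrow> form set \<Rightarrow> bool" where
  "consistent L \<Sigma> \<longleftrightarrow> \<not> (\<exists>\<phi>s. set \<phi>s \<subseteq> \<Sigma> \<and> Neg (big_conj \<phi>s) \<in> L)"

definition frame :: "'a set \<Rightarrow> ('a \<times> 'a) set \<Rightarrow> bool" where
  "frame X I \<longleftrightarrow> I \<subseteq> X \<times> X"

definition model :: "'a set \<Rightarrow> ('a \<times> 'a) set \<Rightarrow> (nat \<Rightarrow> 'a set) \<Rightarrow> bool" where
  "model X I V \<longleftrightarrow> frame X I \<and> (\<forall>p. V p \<subseteq> X)"

primrec true_at :: "('a \<times> 'a) set \<Rightarrow> (nat \<Rightarrow> 'a set) \<Rightarrow> 'a \<Rightarrow> form \<Rightarrow> bool" where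
  "true_at I V a (Var p) \<longleftrightarrow> a \<in> V p"
| "true_at I V a (Neg \<phi>) \<longleftrightarrow> \<not> true_at I V a \<phi>"
| "true_at I V a (Conj \<phi> \<psi>) \<longleftrightarrow> true_at I V a \<phi> \<and> true_at I V a \<psi>"
| "true_at I V a (Box \<phi>) \<longleftrightarrow> (\<forall>b. (a, b) \<in> I \<longrightarrow> true_at I V b \<phi>)"

definition satisfiable_in ::
  "'a set \<Rightarrow> ('a \<times> 'a) set \<Rightarrow> (nat \<Rightarrow> 'a set) \<Rightarrow> form set \<Rightarrow> bool" where
  "satisfiable_in X I V \<Sigma> \<longleftrightarrow> (\<exists>a\<in>X. \<forall>\<phi>\<in>\<Sigma>. true_at I V a \<phi>)"

definition elliptic_plane :: "'a set \<Rightarrow> ('a \<times> 'a) set \<Rightarrow> bool" where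
  "elliptic_plane X I \<longleftrightarrow> frame X I \<and>
     (\<forall>a\<in>X. \<forall>b\<in>X. (a, b) \<in> I O I) \<and>
     (\<forall>a\<in>X. \<forall>b\<in>X. \<forall>c\<in>X. \<forall>d\<in>X.
        (a, b) \<in> I \<and> (b, c) \<in> I \<and> (c, d) \<in> I \<and> (d, a) \<in> I \<longrightarrow> a = c \<or> b = d)"

definition nondegenerate :: "'a set \<Rightarrow> ('a \<times> 'a) set \<Rightarrow> bool" where
  "nondegenerate X I \<longleftrightarrow> (\<exists>a\<in>X. \<exists>b\<in>X. \<exists>c\<in>X. \<exists>d\<in>X.
     (a, b) \<in> I \<and> (b, c) \<in> I \<and> (c, d) \<in> I \<and> a \<noteq> c \<and> b \<noteq> d \<and>
     (a, c) \<notin> I \<and> (b, d) \<notin> I)"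

text \<open>
  HOL cannot quantify existentially over the type in which the points of a plane live, so an
  ambient type has to be fixed. This one has the cardinality of the continuum, like the set of
  all sets of formulas in which canonical models live. Nothing is lost: the conditions on
  planes are first-order and there are countably many formulas, so by the downward
  Loewenheim-Skolem theorem a set of formulas satisfiable on some non-degenerate elliptic plane
  (over any type) is satisfiable on one with countably many points.
\<close>

type_synonym point = "nat set"

end

theory Submission
  imports Defs "HOL-Library.Countable"
begin

text \<open>
  The part of the canonical frame of 8f that is accessible from a fixed point in two steps is
  symmetric, and any two of its points have a common neighbour. A non-degenerate elliptic plane
  that maps onto enough of it is built freely, as a graph without loops and 4-cycles whose
  vertices are labelled by points of the canonical frame: starting with a path of length three,
  each step adds one vertex, which is either joined to a single vertex, as a witness for a
  diamond formula in its label, or joined to two vertices without a common neighbour. Neither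
  creates a 4-cycle.
\<close>

section \<open>Maximal consistent theories\<close>

lemma normal_logic_Inter:
  assumes "\<And>L. L \<in> \<L> \<Longrightarrow> normal_logic L"
  shows "normal_logic (\<Inter> \<L>)"
  using assms unfolding normal_logic_def by blast

locale normal_modal_logic =
  fixes L :: "form set"
  assumes normal: "normal_logic L"
begin

lemma taut: "tautology \<phi> \<Longrightarrow> \<phi> \<in> L"
  and K: "Imp (Box (Imp \<phi> \<psi>)) (Imp (Box \<phi>) (Box \<psi>)) \<in> L"
  and mp: "Imp \<phi> \<psi> \<in> L \<Longrightarrow> \<phi> \<in> L \<Longrightarrow> \<psi> \<in> L"
  and nec: "\<phi> \<in> L \<Longrightarrow> Box \<phi> \<in> L"
  using normal unfolding normal_logic_def by blast+

text \<open>Closure under necessitation is not demanded: these are the theories of the local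
  consequence relation of \<open>L\<close>, with the set of all formulas among them.\<close>

definition closed_theory :: "form set \<Rightarrow> bool" where
  "closed_theory T \<longleftrightarrow> L \<subseteq> T \<and> (\<forall>\<phi> \<psi>. Imp \<phi> \<psi> \<in> T \<longrightarrow> \<phi> \<in> T \<longrightarrow> \<psi> \<in> T)"

text \<open>The equivalence expresses consistency and completeness at once.\<close>

definition mcs :: "form set \<Rightarrow> bool" where
  "mcs M \<longleftrightarrow> closed_theory M \<and> (\<forall>\<phi>. Neg \<phi> \<in> M \<longleftrightarrow> \<phi> \<notin> M)"

definition unbox :: "form set \<Rightarrow> form set" where
  "unbox T = {\<phi>. Box \<phi> \<in> T}"

lemma closed_theory_mp: "closed_theory T \<Longrightarrow> Imp \<phi> \<psi> \<in> T \<Longrightarrow> \<phi> \<in> T \<Longrightarrow> \<psi> \<in> T"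
  unfolding closed_theory_def by blast

lemma closed_theory_logic: "closed_theory T \<Longrightarrow> \<phi> \<in> L \<Longrightarrow> \<phi> \<in> T"
  unfolding closed_theory_def by blast

lemma closed_theory_taut1:
  assumes "closed_theory T" "\<phi> \<in> T" "tautology (Imp \<phi> \<psi>)"
  shows "\<psi> \<in> T"
  using assms closed_theory_mp closed_theory_logic taut by blast

lemma closed_theory_taut2:
  assumes "closed_theory T" "\<phi> \<in> T" "\<psi> \<in> T" "tautology (Imp \<phi> (Imp \<psi> \<chi>))"
  shows "\<chi> \<in> T"
  using assms closed_theory_mp closed_theory_logic taut by blast

lemma closed_theory_L: "closed_theory L"
  unfolding closed_theory_def using mp by blast

text \<open>Necessitation puts \<open>L\<close> into \<open>unbox T\<close>, and \<open>K\<close>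
  gives modus ponens. Hence Lindenbaum's lemma can be applied to \<open>unbox T\<close> directly,
  which is how successors are obtained.\<close>

lemma closed_theory_unbox:
  assumes "closed_theory T"
  shows "closed_theory (unbox T)"
proof -
  have "\<phi> \<in> unbox T" if "\<phi> \<in> L" for \<phi>
    using that nec closed_theory_logic[OF assms] by (simp add: unbox_def)
  moreover have "\<psi> \<in> unbox T" if "Imp \<phi> \<psi> \<in> unbox T" "\<phi> \<in> unbox T" for \<phi> \<psi>
    using that closed_theory_mp[OF assms] closed_theory_logic[OF assms K] unfolding unbox_def
    by blast
  ultimately show ?thesis
    unfolding closed_theory_def by blast
qed

text \<open>Since \<open>B\<close> is directed under implication in \<open>T\<close>, finitely many
  premises from \<open>B\<close> can be replaced by a single one, so the set in question is the
  deductive closure of \<open>T \<union> B\<close>.\<close>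

lemma closed_theory_adjoin:
  assumes T: "closed_theory T" and "B \<noteq> {}"
    and conj: "\<And>\<phi> \<psi>. \<phi> \<in> B \<Longrightarrow> \<psi> \<in> B \<Longrightarrow> \<exists>\<theta>\<in>B. Imp \<theta> (Conj \<phi> \<psi>) \<in> T"
  shows "closed_theory {\<chi>. \<exists>\<psi>\<in>B. Imp \<psi> \<chi> \<in> T}" (is "closed_theory ?T")
    and "T \<subseteq> {\<chi>. \<exists>\<psi>\<in>B. Imp \<psi> \<chi> \<in> T}"
    and "B \<subseteq> {\<chi>. \<exists>\<psi>\<in>B. Imp \<psi> \<chi> \<in> T}"
proof -
  show "T \<subseteq> ?T"
  proof
    fix \<chi> assume "\<chi> \<in> T"
    then have "Imp \<psi> \<chi> \<in> T" for \<psi>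
      by (rule closed_theory_taut1[OF T]) (auto simp: tautology_def)
    then show "\<chi> \<in> ?T" using \<open>B \<noteq> {}\<close> by blast
  qed
  then have "L \<subseteq> ?T" using T unfolding closed_theory_def by blast
  moreover have "\<chi> \<in> ?T" if imp: "Imp \<phi> \<chi> \<in> ?T" and phi: "\<phi> \<in> ?T" for \<phi> \<chi>
  proof -
    obtain \<psi> \<psi>' where psi: "\<psi> \<in> B" "Imp \<psi> (Imp \<phi> \<chi>) \<in> T" "\<psi>' \<in> B" "Imp \<psi>' \<phi> \<in> T"
      using imp phi by blast
    obtain \<theta> where theta: "\<theta> \<in> B" "Imp \<theta> (Conj \<psi> \<psi>') \<in> T" using conj psi by blast
    have "Imp (Conj \<psi> \<psi>') \<chi> \<in> T"
      by (rule closed_theory_taut2[OF T psi(2,4)]) (auto simp: tautology_def)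
    from theta(2) this have "Imp \<theta> \<chi> \<in> T"
      by (rule closed_theory_taut2[OF T]) (auto simp: tautology_def)
    with theta show ?thesis by blast
  qed
  ultimately show "closed_theory ?T" unfolding closed_theory_def by blast
  have "Imp \<psi> \<psi> \<in> T" for \<psi>
    by (rule closed_theory_logic[OF T taut]) (auto simp: tautology_def)
  then show "B \<subseteq> ?T" by blast
qed

text \<open>Zorn's lemma is applied to the extensions of \<open>T\<close> that omit
  \<open>\<phi>\<close>. A maximal one decides every \<open>\<psi>\<close>: if \<open>\<psi>\<close>
  and its negation were both missing, each would imply \<open>\<phi>\<close>, and then
  \<open>\<phi>\<close> would be a member.\<close>

lemma lindenbaum:
  assumes T: "closed_theory T" and "\<phi> \<notin> T"
  shows "\<exists>M. mcs M \<and> T \<subseteq> M \<and> \<phi> \<notin> M"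
proof -
  define A where "A = {M. closed_theory M \<and> T \<subseteq> M \<and> \<phi> \<notin> M}"
  have "\<exists>M\<in>A. \<forall>X\<in>A. M \<subseteq> X \<longrightarrow> X = M"
  proof (rule subset_Zorn_nonempty)
    show "A \<noteq> {}" using assms unfolding A_def by blast
  next
    fix \<C> assume "\<C> \<noteq> {}" and chain: "subset.chain A \<C>"
    then have C: "closed_theory M \<and> T \<subseteq> M \<and> \<phi> \<notin> M" if "M \<in> \<C>" for M
      using that unfolding A_def subset_chain_def by blast
    have "\<chi> \<in> \<Union>\<C>" if "Imp \<psi> \<chi> \<in> \<Union>\<C>" "\<psi> \<in> \<Union>\<C>" for \<psi> \<chi>
    proof -
      obtain M N where MN: "M \<in> \<C>" "N \<in> \<C>" "Imp \<psi> \<chi> \<in> M" "\<psi> \<in> N"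
        using \<open>Imp \<psi> \<chi> \<in> \<Union>\<C>\<close> \<open>\<psi> \<in> \<Union>\<C>\<close> by blast
      have "M \<subseteq> N \<or> N \<subseteq> M" using chain MN unfolding subset_chain_def by blast
      then show ?thesis using MN C closed_theory_mp by blast
    qed
    moreover have "L \<subseteq> \<Union>\<C>" "T \<subseteq> \<Union>\<C>"
      using \<open>\<C> \<noteq> {}\<close> C unfolding closed_theory_def by blast+
    ultimately show "\<Union>\<C> \<in> A" using C unfolding A_def closed_theory_def by blast
  qed
  then obtain M where "M \<in> A" and max_A: "\<forall>X\<in>A. M \<subseteq> X \<longrightarrow> X = M" ..
  then have M: "closed_theory M" "T \<subseteq> M" "\<phi> \<notin> M" unfolding A_def by simp_all
  have max: "X = M" if "closed_theory X" "T \<subseteq> X" "\<phi> \<notin> X" "M \<subseteq> X" for X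
    using max_A that unfolding A_def by simp
  \<comment> \<open>Adjoining a missing \<open>\<psi>\<close> enlarges \<open>M\<close> properly, so
    by maximality the enlarged theory contains \<open>\<phi>\<close>.\<close>
  have imp: "Imp \<psi> \<phi> \<in> M" if "\<psi> \<notin> M" for \<psi>
  proof -
    have "Imp \<psi> (Conj \<psi> \<psi>) \<in> M"
      by (rule closed_theory_logic[OF M(1) taut]) (auto simp: tautology_def)
    then have "\<exists>\<theta>\<in>{\<psi>}. Imp \<theta> (Conj \<phi>' \<psi>') \<in> M" if "\<phi>' \<in> {\<psi>}" "\<psi>' \<in> {\<psi>}" for \<phi>' \<psi>'
      using that by simp
    note adjoin = closed_theory_adjoin[OF M(1) insert_not_empty this]
    have "\<phi> \<in> {\<chi>. \<exists>\<theta>\<in>{\<psi>}. Imp \<theta> \<chi> \<in> M}"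
    proof (rule ccontr)
      assume "\<not> ?thesis"
      then have "{\<chi>. \<exists>\<theta>\<in>{\<psi>}. Imp \<theta> \<chi> \<in> M} = M"
        using max[OF adjoin(1)] adjoin(2) M(2) by auto
      then show False using adjoin(3) that by simp
    qed
    then show ?thesis by simp
  qed
  have "Neg \<psi> \<in> M \<longleftrightarrow> \<psi> \<notin> M" for \<psi>
  proof
    assume "Neg \<psi> \<in> M"
    show "\<psi> \<notin> M"
    proof
      assume "\<psi> \<in> M"
      with \<open>Neg \<psi> \<in> M\<close> have "\<phi> \<in> M"
        by (rule closed_theory_taut2[OF M(1)]) (auto simp: tautology_def)
      with M(3) show False ..
    qed
  next
    assume "\<psi> \<notin> M"
    show "Neg \<psi> \<in> M"
    proof (rule ccontr)
      assume "Neg \<psi> \<notin> M"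
      with \<open>\<psi> \<notin> M\<close> have "Imp \<psi> \<phi> \<in> M" "Imp (Neg \<psi>) \<phi> \<in> M" by (blast intro: imp)+
      then have "\<phi> \<in> M"
        by (rule closed_theory_taut2[OF M(1)]) (auto simp: tautology_def)
      with M(3) show False ..
    qed
  qed
  with M show ?thesis unfolding mcs_def by blast
qed

text \<open>As \<open>B\<close> is closed under conjunction, an inconsistency of
  \<open>A \<union> B\<close> would already come from a single member of \<open>B\<close>.\<close>

lemma mcs_joint_extension:
  assumes A: "closed_theory A" and B: "closed_theory B"
    and compat: "\<And>\<psi>. \<psi> \<in> B \<Longrightarrow> Neg \<psi> \<notin> A"
  shows "\<exists>M. mcs M \<and> A \<subseteq> M \<and> B \<subseteq> M"
proof -
  define T where "T = {\<chi>. \<exists>\<psi>\<in>B. Imp \<psi> \<chi> \<in> A}"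
  have top: "Top \<in> T'" if "closed_theory T'" for T'
    by (rule closed_theory_logic[OF that taut]) (auto simp: tautology_def)
  have "\<exists>\<theta>\<in>B. Imp \<theta> (Conj \<phi> \<psi>) \<in> A" if "\<phi> \<in> B" "\<psi> \<in> B" for \<phi> \<psi>
  proof
    show "Conj \<phi> \<psi> \<in> B"
      by (rule closed_theory_taut2[OF B that]) (auto simp: tautology_def)
    show "Imp (Conj \<phi> \<psi>) (Conj \<phi> \<psi>) \<in> A"
      by (rule closed_theory_logic[OF A taut]) (auto simp: tautology_def)
  qed
  then have T: "closed_theory T" "A \<subseteq> T" "B \<subseteq> T"
    unfolding T_def using closed_theory_adjoin[OF A, of B] top[OF B] by blast+
  have "Neg Top \<notin> T"
  proof
    assume "Neg Top \<in> T"
    then obtain \<psi> where "\<psi> \<in> B" "Imp \<psi> (Neg Top) \<in> A" unfolding T_def by blast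
    from this(2) have "Neg \<psi> \<in> A"
      by (rule closed_theory_taut1[OF A]) (auto simp: tautology_def)
    with compat \<open>\<psi> \<in> B\<close> show False by blast
  qed
  then show ?thesis using lindenbaum[OF T(1)] T by blast
qed

lemma consistent_imp_mcs:
  assumes "consistent L \<Sigma>"
  shows "\<exists>M. mcs M \<and> \<Sigma> \<subseteq> M"
proof -
  \<comment> \<open>Concatenation of lists makes this set of finite conjunctions directed, and the
    empty list makes it non-empty, so it can be adjoined to \<open>L\<close>.\<close>
  define B where "B = big_conj ` {\<phi>s. set \<phi>s \<subseteq> \<Sigma>}"
  have eval: "prop_eval v (big_conj \<phi>s) \<longleftrightarrow> (\<forall>\<phi>\<in>set \<phi>s. prop_eval v \<phi>)" for v \<phi>s
    unfolding big_conj_def by (induction \<phi>s) auto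
  have "big_conj [] \<in> B" unfolding B_def by auto
  moreover have "\<exists>\<theta>\<in>B. Imp \<theta> (Conj \<phi> \<psi>) \<in> L" if "\<phi> \<in> B" "\<psi> \<in> B" for \<phi> \<psi>
  proof -
    obtain \<phi>s \<psi>s where "set \<phi>s \<subseteq> \<Sigma>" "set \<psi>s \<subseteq> \<Sigma>" "\<phi> = big_conj \<phi>s" "\<psi> = big_conj \<psi>s"
      using \<open>\<phi> \<in> B\<close> \<open>\<psi> \<in> B\<close> unfolding B_def by blast
    moreover have "Imp (big_conj (\<phi>s @ \<psi>s)) (Conj (big_conj \<phi>s) (big_conj \<psi>s)) \<in> L"
      by (rule taut) (auto simp: tautology_def eval)
    moreover have "big_conj (\<phi>s @ \<psi>s) \<in> B"
      unfolding B_def using calculation by (intro imageI) auto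
    ultimately show ?thesis by blast
  qed
  ultimately have T: "closed_theory {\<chi>. \<exists>\<psi>\<in>B. Imp \<psi> \<chi> \<in> L}"
    using closed_theory_adjoin(1)[OF closed_theory_L, of B] by blast
  have "Neg Top \<notin> {\<chi>. \<exists>\<psi>\<in>B. Imp \<psi> \<chi> \<in> L}"
  proof
    assume "Neg Top \<in> {\<chi>. \<exists>\<psi>\<in>B. Imp \<psi> \<chi> \<in> L}"
    then obtain \<phi>s where "set \<phi>s \<subseteq> \<Sigma>" "Imp (big_conj \<phi>s) (Neg Top) \<in> L"
      unfolding B_def by blast
    from this(2) have "Neg (big_conj \<phi>s) \<in> L"
      by (rule closed_theory_taut1[OF closed_theory_L]) (auto simp: tautology_def)
    with assms \<open>set \<phi>s \<subseteq> \<Sigma>\<close> show False unfolding consistent_def by blast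
  qed
  with lindenbaum[OF T] obtain M where M: "mcs M" "{\<chi>. \<exists>\<psi>\<in>B. Imp \<psi> \<chi> \<in> L} \<subseteq> M" by blast
  have "\<phi> \<in> M" if "\<phi> \<in> \<Sigma>" for \<phi>
  proof -
    have "big_conj [\<phi>] \<in> B" unfolding B_def using that by auto
    moreover have "Imp (big_conj [\<phi>]) \<phi> \<in> L" by (rule taut) (auto simp: tautology_def eval)
    ultimately show ?thesis using M(2) by blast
  qed
  with M(1) show ?thesis by blast
qed

section \<open>Connectives in maximal consistent theories\<close>

lemma mcs_Neg: "mcs M \<Longrightarrow> Neg \<phi> \<in> M \<longleftrightarrow> \<phi> \<notin> M"
  and mcs_closed: "mcs M \<Longrightarrow> closed_theory M"
  unfolding mcs_def by blast+

lemma mcs_Conj: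
  assumes "mcs M"
  shows "Conj \<phi> \<psi> \<in> M \<longleftrightarrow> \<phi> \<in> M \<and> \<psi> \<in> M"
proof -
  note taut1 = closed_theory_taut1[OF mcs_closed[OF assms], of "Conj \<phi> \<psi>"]
    and taut2 = closed_theory_taut2[OF mcs_closed[OF assms], of \<phi> \<psi>]
  show ?thesis
    using taut1[of \<phi>] taut1[of \<psi>] taut2[of "Conj \<phi> \<psi>"] by (auto simp: tautology_def)
qed

text \<open>If \<open>Box \<phi>\<close> is missing from \<open>M\<close>, then
  \<open>unbox M\<close> omits \<open>\<phi>\<close> and Lindenbaum's lemma provides the
  successor.\<close>

lemma mcs_Box:
  assumes "mcs M"
  shows "Box \<phi> \<in> M \<longleftrightarrow> (\<forall>N. mcs N \<longrightarrow> unbox M \<subseteq> N \<longrightarrow> \<phi> \<in> N)"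
  using lindenbaum[OF closed_theory_unbox[OF mcs_closed[OF assms]], of \<phi>]
  unfolding unbox_def by blast

text \<open>\<open>Dia\<close> abbreviates a negated box of a negation, so double negations arise
  under boxes and have to be removed there.\<close>

lemma Box_Neg_Neg_iff:
  assumes "closed_theory T"
  shows "Box (Neg (Neg \<phi>)) \<in> T \<longleftrightarrow> Box \<phi> \<in> T"
  using closed_theory_taut1[OF closed_theory_unbox[OF assms], of \<phi> "Neg (Neg \<phi>)"]
    closed_theory_taut1[OF closed_theory_unbox[OF assms], of "Neg (Neg \<phi>)" \<phi>]
  by (auto simp: unbox_def tautology_def)

end

section \<open>The canonical frame of 8f\<close>

lemma normal_logic_8f: "normal_logic logic_8f"
  unfolding logic_8f_def by (rule normal_logic_Inter) blast

lemma axiom_D: "Imp (Box \<phi>) (Dia \<phi>) \<in> logic_8f"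
  and axiom_B: "Imp (Dia (Box \<phi>)) \<phi> \<in> logic_8f"
  and axiom_4_2: "Imp (Box (Box \<phi>)) (Box (Box (Box (Box \<phi>)))) \<in> logic_8f"
  and axiom_T_3: "Imp (Box (Box (Box \<phi>))) \<phi> \<in> logic_8f"
proof -
  have "logic_12g \<subseteq> logic_8f" unfolding logic_8f_def by blast
  then show "Imp (Box \<phi>) (Dia \<phi>) \<in> logic_8f" "Imp (Dia (Box \<phi>)) \<phi> \<in> logic_8f"
    "Imp (Box (Box \<phi>)) (Box (Box (Box (Box \<phi>)))) \<in> logic_8f"
    unfolding logic_12g_def by blast+
  show "Imp (Box (Box (Box \<phi>))) \<phi> \<in> logic_8f" unfolding logic_8f_def by blast
qed

interpretation L8f: normal_modal_logic logic_8f
  by unfold_locales (rule normal_logic_8f)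

definition can8 :: "form set \<Rightarrow> form set \<Rightarrow> bool" where
  "can8 a b \<longleftrightarrow> L8f.mcs a \<and> L8f.mcs b \<and> L8f.unbox a \<subseteq> b"

lemma mcs_8f_mp:
  assumes "L8f.mcs a" "Imp \<phi> \<psi> \<in> logic_8f" "\<phi> \<in> a"
  shows "\<psi> \<in> a"
  using assms L8f.closed_theory_mp L8f.closed_theory_logic L8f.mcs_closed by blast

text \<open>If \<open>Box \<phi> \<in> b\<close>, then \<open>Dia (Box \<phi>) \<in> a\<close>,
  since otherwise \<open>Neg (Box \<phi>)\<close> would be passed on to \<open>b\<close>; now
  \<open>axiom_B\<close> applies.\<close>

lemma can8_sym: "can8 a b \<Longrightarrow> can8 b a"
proof -
  assume ab: "can8 a b"
  have "\<phi> \<in> a" if "Box \<phi> \<in> b" for \<phi>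
  proof -
    have "Neg (Box \<phi>) \<notin> b" using ab that L8f.mcs_Neg unfolding can8_def by blast
    then have "Dia (Box \<phi>) \<in> a"
      using ab L8f.mcs_Neg unfolding can8_def L8f.unbox_def by blast
    then show ?thesis using mcs_8f_mp axiom_B ab unfolding can8_def by blast
  qed
  then show ?thesis using ab unfolding can8_def L8f.unbox_def by blast
qed

lemma symp_can8: "symp can8"
  by (rule sympI) (rule can8_sym)

lemma can8_serial:
  assumes "L8f.mcs a"
  shows "\<exists>b. can8 a b"
proof -
  have "Top \<in> L8f.unbox a"
    by (rule L8f.closed_theory_logic[OF L8f.closed_theory_unbox[OF L8f.mcs_closed[OF assms]]
          L8f.taut]) (auto simp: tautology_def)
  then have "Dia Top \<in> a"
    using mcs_8f_mp[OF assms axiom_D] unfolding L8f.unbox_def by blast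
  then have "Neg Top \<notin> L8f.unbox a"
    using L8f.mcs_Neg[OF assms] unfolding L8f.unbox_def by blast
  then show ?thesis
    using L8f.lindenbaum[OF L8f.closed_theory_unbox[OF L8f.mcs_closed[OF assms]]] assms
    unfolding can8_def by blast
qed

text \<open>This lets reasoning about canonical successors replace formal derivations under a
  box.\<close>

lemma Box_mono:
  assumes "L8f.mcs a" "Box \<phi> \<in> a" "\<And>b. can8 a b \<Longrightarrow> \<phi> \<in> b \<Longrightarrow> \<psi> \<in> b"
  shows "Box \<psi> \<in> a"
  using assms L8f.mcs_Box[OF assms(1)] unfolding can8_def by blast

lemma Box_Dia: "L8f.mcs a \<Longrightarrow> \<phi> \<in> a \<Longrightarrow> Box (Dia \<phi>) \<in> a"
proof -
  assume a: "L8f.mcs a" and "\<phi> \<in> a"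
  have "Dia \<phi> \<in> b" if "can8 a b" for b
  proof (rule ccontr)
    assume "Dia \<phi> \<notin> b"
    then have "Box (Neg \<phi>) \<in> b" using that L8f.mcs_Neg unfolding can8_def by blast
    then have "Neg \<phi> \<in> a" using can8_sym[OF that] unfolding can8_def L8f.unbox_def by blast
    then show False using \<open>\<phi> \<in> a\<close> L8f.mcs_Neg[OF a] by blast
  qed
  then show ?thesis using L8f.mcs_Box[OF a] a unfolding can8_def by blast
qed

text \<open>
  By symmetry a common neighbour of \<open>a\<close> and \<open>b\<close> is an extension of \<open>unbox a \<union> unbox b\<close>.
\<close>

lemma can8_two_steps:
  assumes a: "L8f.mcs a" and b: "L8f.mcs b" and ab: "L8f.unbox (L8f.unbox a) \<subseteq> b"
  shows "\<exists>c. can8 a c \<and> can8 c b"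
proof -
  have "Neg \<psi> \<notin> L8f.unbox a" if psi: "\<psi> \<in> L8f.unbox b" for \<psi>
  proof
    assume neg: "Neg \<psi> \<in> L8f.unbox a"
    \<comment> \<open>Each successor of \<open>a\<close> contains \<open>Neg \<psi>\<close>, so by
      \<open>Box_Dia\<close> each of their successors contains \<open>Dia (Neg \<psi>)\<close>. Two
      steps lead to \<open>b\<close>, where this contradicts \<open>Box \<psi>\<close>.\<close>
    have "Box (Box (Dia (Neg \<psi>))) \<in> a"
      by (rule Box_mono[OF a, of "Neg \<psi>"]) (use neg Box_Dia in \<open>auto simp: can8_def L8f.unbox_def\<close>)
    then have "Dia (Neg \<psi>) \<in> b" using ab unfolding L8f.unbox_def by blast
    then show False
      using psi L8f.mcs_Neg[OF b] L8f.Box_Neg_Neg_iff[OF L8f.mcs_closed[OF b]]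
      unfolding L8f.unbox_def by auto
  qed
  with L8f.mcs_joint_extension[of "L8f.unbox a" "L8f.unbox b"]
  obtain c where "L8f.mcs c" "L8f.unbox a \<subseteq> c" "L8f.unbox b \<subseteq> c"
    using L8f.closed_theory_unbox L8f.mcs_closed a b by meson
  then show ?thesis using a b can8_sym unfolding can8_def by blast
qed

text \<open>\<open>axiom_T_3\<close> corresponds to a closed walk of length three through every
  point. The point \<open>c\<close> is found as a joint extension that is both one step and two
  steps away from \<open>a\<close>.\<close>

lemma can8_triangle:
  assumes a: "L8f.mcs a"
  shows "\<exists>b c. can8 a b \<and> can8 b c \<and> can8 c a"
proof -
  have "Neg \<psi> \<notin> L8f.unbox a" if psi: "\<psi> \<in> L8f.unbox (L8f.unbox a)" for \<psi>
  proof
    assume neg: "Neg \<psi> \<in> L8f.unbox a"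
    \<comment> \<open>Going out three steps, the last two are retraced by \<open>Dia (Dia _)\<close>
      to a successor of \<open>a\<close>, where \<open>Neg \<psi>\<close> holds.
      \<open>axiom_T_3\<close> brings \<open>Dia (Dia (Neg \<psi>))\<close> back to
      \<open>a\<close>, against \<open>Box (Box \<psi>) \<in> a\<close>.\<close>
    have "Box (Box (Box (Dia (Dia (Neg \<psi>))))) \<in> a"
    proof (rule Box_mono[OF a])
      show "Box (Neg \<psi>) \<in> a" using neg unfolding L8f.unbox_def by blast
      fix b assume b: "can8 a b" "Neg \<psi> \<in> b"
      show "Box (Box (Dia (Dia (Neg \<psi>)))) \<in> b"
      proof (rule Box_mono)
        show "L8f.mcs b" "Box (Dia (Neg \<psi>)) \<in> b" using b Box_Dia unfolding can8_def by blast+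
      qed (use Box_Dia in \<open>auto simp: can8_def\<close>)
    qed
    then have "Dia (Dia (Neg \<psi>)) \<in> a" using mcs_8f_mp[OF a axiom_T_3] by blast
    then obtain b where b: "can8 a b" "Neg (Dia (Neg \<psi>)) \<notin> b"
      using L8f.mcs_Neg[OF a] L8f.mcs_Box[OF a] a unfolding can8_def by blast
    then have "Box \<psi> \<notin> b"
      using L8f.mcs_Neg L8f.Box_Neg_Neg_iff L8f.mcs_closed unfolding can8_def by blast
    then show False using b psi unfolding can8_def L8f.unbox_def by blast
  qed
  with L8f.mcs_joint_extension[of "L8f.unbox a" "L8f.unbox (L8f.unbox a)"]
  obtain c where c: "L8f.mcs c" "L8f.unbox a \<subseteq> c" "L8f.unbox (L8f.unbox a) \<subseteq> c"
    using L8f.closed_theory_unbox L8f.mcs_closed a by meson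
  then have "can8 c a" using a can8_sym unfolding can8_def by blast
  with can8_two_steps[OF a c(1,3)] show ?thesis by blast
qed

text \<open>This is the frame condition of \<open>axiom_4_2\<close>: whatever is doubly boxed at
  \<open>a\<close> survives four steps.\<close>

lemma can8_two_steps_trans:
  assumes "can8 a b" "can8 b c" "can8 c d" "can8 d e"
  shows "\<exists>x. can8 a x \<and> can8 x e"
proof (rule can8_two_steps)
  show a: "L8f.mcs a" and "L8f.mcs e" using assms unfolding can8_def by blast+
  show "L8f.unbox (L8f.unbox a) \<subseteq> e"
  proof
    fix \<phi> assume "\<phi> \<in> L8f.unbox (L8f.unbox a)"
    then have "Box (Box (Box (Box \<phi>))) \<in> a"
      using mcs_8f_mp[OF a axiom_4_2] unfolding L8f.unbox_def by blast
    then show "\<phi> \<in> e" using assms unfolding can8_def L8f.unbox_def by blast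
  qed
qed

text \<open>The closed walk of length three at \<open>a\<close>, followed by the step to
  \<open>b\<close>, has length four and shrinks to two steps.\<close>

lemma can8_imp_two_steps:
  assumes "can8 a b"
  shows "\<exists>x. can8 a x \<and> can8 x b"
proof -
  have "L8f.mcs a" using assms unfolding can8_def by blast
  from can8_triangle[OF this] obtain u v where uv: "can8 a u" "can8 u v" "can8 v a" by blast
  show ?thesis by (rule can8_two_steps_trans[OF uv assms])
qed

section \<open>The free construction\<close>

definition no_4_cycle :: "('a \<times> 'a) set \<Rightarrow> bool" where
  "no_4_cycle E \<longleftrightarrow>
     (\<forall>a b c d. (a, b) \<in> E \<and> (b, c) \<in> E \<and> (c, d) \<in> E \<and> (d, a) \<in> E \<longrightarrow> a = c \<or> b = d)"

text \<open>A finite stage of the construction. Labels from \<open>n\<close> on are placeholders,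
  overwritten when their vertices are added.\<close>

definition network ::
  "'w set \<Rightarrow> ('w \<Rightarrow> 'w \<Rightarrow> bool) \<Rightarrow> nat \<Rightarrow> (nat \<times> nat) set \<Rightarrow> (nat \<Rightarrow> 'w) \<Rightarrow> bool" where
  "network W J n E l \<longleftrightarrow> E \<subseteq> {..<n} \<times> {..<n} \<and> sym E \<and> irrefl E \<and> no_4_cycle E \<and>
     range l \<subseteq> W \<and> (\<forall>(x, y) \<in> E. J (l x) (l y))"

text \<open>In a closed walk of length four through the new vertex \<open>n\<close>, its neighbours
  on the walk lie in \<open>S\<close>. Unless the opposite vertex is \<open>n\<close> as well, it is
  a common neighbour of them in \<open>E\<close>, so they coincide.\<close>

lemma network_extend:
  assumes net: "network W J n E l" and J_sym: "symp J"
    and S: "S \<subseteq> {..<n}" and w: "w \<in> W" "\<And>x. x \<in> S \<Longrightarrow> J (l x) w"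
    and common: "\<And>x y z. x \<in> S \<Longrightarrow> y \<in> S \<Longrightarrow> (x, z) \<in> E \<Longrightarrow> (z, y) \<in> E \<Longrightarrow> x = y"
  shows "network W J (Suc n) (E \<union> S \<times> {n} \<union> {n} \<times> S) (l(n := w))"
proof -
  have E: "E \<subseteq> {..<n} \<times> {..<n}" "sym E" "irrefl E" "range l \<subseteq> W"
      "\<And>x y. (x, y) \<in> E \<Longrightarrow> J (l x) (l y)"
    and no4: "\<And>a b c d. (a, b) \<in> E \<Longrightarrow> (b, c) \<in> E \<Longrightarrow> (c, d) \<in> E \<Longrightarrow> (d, a) \<in> E \<Longrightarrow> a = c \<or> b = d"
    using net unfolding network_def no_4_cycle_def by blast+
  let ?E = "E \<union> S \<times> {n} \<union> {n} \<times> S"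
  have edge: "(x, y) \<in> ?E \<longleftrightarrow> (x, y) \<in> E \<and> x \<noteq> n \<and> y \<noteq> n \<or>
      x \<in> S \<and> y = n \<and> x \<noteq> n \<or> x = n \<and> y \<in> S \<and> y \<noteq> n" for x y
    using E(1) S by auto
  have "a = c \<or> b = d"
    if "(a, b) \<in> ?E" "(b, c) \<in> ?E" "(c, d) \<in> ?E" "(d, a) \<in> ?E" for a b c d
  proof (cases "a = n \<or> b = n \<or> c = n \<or> d = n")
    case True
    then show ?thesis
    proof (elim disjE)
      assume "a = n" then show ?thesis using that common[of b d c] unfolding edge by blast
    next
      assume "b = n" then show ?thesis using that common[of c a d] unfolding edge by blast
    next
      assume "c = n" then show ?thesis using that common[of d b a] unfolding edge by blast
    next
      assume "d = n" then show ?thesis using that common[of a c b] unfolding edge by blast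
    qed
  next
    case False
    then show ?thesis using that no4[of a b c d] unfolding edge by blast
  qed
  then have "no_4_cycle ?E" unfolding no_4_cycle_def by blast
  moreover have "?E \<subseteq> {..<Suc n} \<times> {..<Suc n}" using E(1) S by auto
  moreover have "sym ?E" using E(2) unfolding sym_def by blast
  moreover have "irrefl ?E" using E(3) S unfolding irrefl_def by auto
  moreover have "range (l(n := w)) \<subseteq> W" using E(4) w(1) by auto
  moreover have "J ((l(n := w)) x) ((l(n := w)) y)" if "(x, y) \<in> ?E" for x y
    using that E(5) w(2) sympD[OF J_sym] unfolding edge by auto
  ultimately show ?thesis unfolding network_def by blast
qed

text \<open>
  The sets \<open>D k\<close> abstract the sets of canonical points that contain the \<open>k\<close>-th formula.
\<close>

definition network_step ::
  "'w set \<Rightarrow> ('w \<Rightarrow> 'w \<Rightarrow> bool) \<Rightarrow> (nat \<Rightarrow> 'w set) \<Rightarrow> nat \<times> (nat + nat) \<Rightarrow>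
    (nat \<times> nat) set \<Rightarrow> (nat \<Rightarrow> 'w) \<Rightarrow> (nat \<times> nat) set \<Rightarrow> (nat \<Rightarrow> 'w) \<Rightarrow> bool" where
  "network_step W J D t E l E' l' \<longleftrightarrow> (case t of
     (x, Inl y) \<Rightarrow> (x, y) \<in> E' O E'
   | (x, Inr k) \<Rightarrow> (\<exists>w\<in>W. J (l x) w \<and> w \<in> D k) \<longrightarrow> (\<exists>y. (x, y) \<in> E' \<and> l' y \<in> D k))"

text \<open>A vertex is added even when the task asks for nothing; it is then isolated. So the
  number of vertices is determined by the step. Both edges and non-edges among old vertices are
  preserved.\<close>

lemma network_repair:
  assumes net: "network W J n E l" and J_sym: "symp J"
    and total: "\<forall>v\<in>W. \<forall>w\<in>W. \<exists>u\<in>W. J v u \<and> J u w"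
    and x: "x < n" and r: "\<And>y. r = Inl y \<Longrightarrow> y < n"
  shows "\<exists>E' l'. network W J (Suc n) E' l' \<and> E' \<inter> {..<n} \<times> {..<n} = E \<and>
    (\<forall>z<n. l' z = l z) \<and> network_step W J D (x, r) E l E' l'"
proof -
  have E: "E \<subseteq> {..<n} \<times> {..<n}" and lW: "l z \<in> W" for z
    using net unfolding network_def by auto
  have extend: "?thesis"
    if S: "S \<subseteq> {..<n}" "w \<in> W" "\<And>z. z \<in> S \<Longrightarrow> J (l z) w"
      and common: "\<And>u v z. u \<in> S \<Longrightarrow> v \<in> S \<Longrightarrow> (u, z) \<in> E \<Longrightarrow> (z, v) \<in> E \<Longrightarrow> u = v"
      and step: "network_step W J D (x, r) E l (E \<union> S \<times> {n} \<union> {n} \<times> S) (l(n := w))" for S w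
  proof (intro exI conjI)
    show "network W J (Suc n) (E \<union> S \<times> {n} \<union> {n} \<times> S) (l(n := w))"
      using network_extend[OF net J_sym S common] .
    show "(E \<union> S \<times> {n} \<union> {n} \<times> S) \<inter> {..<n} \<times> {..<n} = E" using E S(1) by auto
  qed (use step in auto)
  show ?thesis
  proof (cases r)
    case (Inl y)
    obtain u where u: "u \<in> W" "J (l x) u" "J u (l y)" using total lW by blast
    show ?thesis
    proof (cases "(x, y) \<in> E O E")
      case True
      show ?thesis
        by (rule extend[of "{}" u]) (use True u(1) Inl in \<open>auto simp: network_step_def\<close>)
    next
      case False
      moreover have "sym E" using net unfolding network_def by blast
      ultimately have "(y, x) \<notin> E O E" unfolding sym_def by blast
      \<comment> \<open>The new vertex becomes the common neighbour of \<open>x\<close> and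
        \<open>y\<close>, labelled by a canonical point between their labels. For
        \<open>x = y\<close> it is joined to one vertex only.\<close>
      with False show ?thesis
        by (intro extend[of "{x, y}" u])
          (use x r u sympD[OF J_sym] Inl in \<open>auto simp: network_step_def\<close>)
    qed
  next
    case (Inr k)
    show ?thesis
    proof (cases "\<exists>w\<in>W. J (l x) w \<and> w \<in> D k")
      case True
      then obtain w where "w \<in> W" "J (l x) w" "w \<in> D k" by blast
      then show ?thesis
        by (intro extend[of "{x}" w]) (use x Inr in \<open>auto simp: network_step_def\<close>)
    next
      case False
      then show ?thesis
        by (intro extend[of "{}" "l x"]) (use lW Inr in \<open>auto simp: network_step_def\<close>)
    qed
  qed
qed

text \<open>
  Task \<open>n\<close> only mentions vertices up to \<open>n\<close>, which are already present at step \<open>n\<close>, and its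
  outcome is never undone, so that no task has to be repeated.
\<close>

definition task :: "nat \<Rightarrow> nat \<times> (nat + nat)" where
  "task n = map_prod id sum_decode (prod_decode n)"

lemma task_surj: "\<exists>n. task n = t"
  by (rule exI[of _ "prod_encode (map_prod id sum_encode t)"]) (cases t, simp add: task_def)

lemma task_fst_le: "task n = (x, r) \<Longrightarrow> x \<le> n"
  using le_prod_encode_1[of "fst (prod_decode n)" "snd (prod_decode n)"]
  by (auto simp: task_def map_prod_def split: prod.splits)

lemma task_Inl_le: "task n = (x, Inl y) \<Longrightarrow> y \<le> n"
proof -
  assume "task n = (x, Inl y)"
  then obtain m where m: "prod_decode n = (x, m)" "sum_decode m = Inl y"
    by (cases "prod_decode n") (auto simp: task_def)
  have "m = sum_encode (Inl y)" using m(2) by (metis sum_decode_inverse)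
  then have "y \<le> m" by (simp add: sum_encode_def)
  moreover have "m \<le> n" using le_prod_encode_2[of m x] m(1) by (metis prod_decode_inverse)
  ultimately show "y \<le> n" by simp
qed

text \<open>The plane is the union of a chain of networks. A 4-cycle would already appear at a
  finite stage, and the initial path stays an induced subgraph because no edge is ever added between
  old vertices.\<close>

lemma free_plane:
  fixes W :: "'w set" and D :: "nat \<Rightarrow> 'w set"
  assumes J_sym: "symp J"
    and total: "\<forall>v\<in>W. \<forall>w\<in>W. \<exists>u\<in>W. J v u \<and> J u w"
    and w0: "w0 \<in> W"
  shows "\<exists>E l. no_4_cycle E \<and> E O E = UNIV \<and> range l \<subseteq> W \<and>
    (\<forall>x y. (x, y) \<in> E \<longrightarrow> J (l x) (l y)) \<and>
    (\<forall>x k. (\<exists>w\<in>W. J (l x) w \<and> w \<in> D k) \<longrightarrow> (\<exists>y. (x, y) \<in> E \<and> l y \<in> D k)) \<and>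
    l (0::nat) = w0 \<and>
    E \<inter> {..<4} \<times> {..<4} = {(0,1), (1,0), (1,2), (2,1), (2,3), (3,2)}"
proof -
  define E0 :: "(nat \<times> nat) set" where "E0 = {(0,1), (1,0), (1,2), (2,1), (2,3), (3,2)}"
  \<comment> \<open>The offset 4 counts the vertices of the initial path.\<close>
  define P where "P n = (\<lambda>(E, l). network W J (n + 4) E l \<and> l 0 = w0 \<and>
    E \<inter> {..<4} \<times> {..<4} = E0)" for n
  define Q where "Q n = (\<lambda>(E, l) (E', l'). E' \<inter> {..<n+4} \<times> {..<n+4} = E \<and>
    (\<forall>z<n+4. l' z = l z) \<and> network_step W J D (task n) E l E' l')" for n
  have "\<exists>f. \<forall>n. P n (f n) \<and> Q n (f n) (f (Suc n))"
  proof (rule dependent_nat_choice)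
    \<comment> \<open>A common neighbour of \<open>w0\<close> with itself: the initial path is
      labelled alternately by \<open>w0\<close> and \<open>v\<close>.\<close>
    obtain v where v: "v \<in> W" "J w0 v" "J v w0" using total w0 by blast
    have "network W J 0 {} (\<lambda>_. w0)"
      using w0 by (auto simp: network_def no_4_cycle_def sym_def irrefl_def)
    from network_extend[OF this J_sym, of "{}" w0]
    have "network W J 1 {} (\<lambda>_. w0)" using w0 by (simp add: fun_upd_idem)
    from network_extend[OF this J_sym, of "{0}" v]
    have "network W J 2 {(0,1), (1,0)} ((\<lambda>_. w0)(1 := v))"
      using v by (simp add: numeral_2_eq_2 insert_commute)
    from network_extend[OF this J_sym, of "{1}" w0]
    have "network W J 3 {(0,1), (1,0), (1,2), (2,1)} ((\<lambda>_. w0)(1 := v, 2 := w0))"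
      using v w0 by (simp add: eval_nat_numeral insert_commute)
    from network_extend[OF this J_sym, of "{2}" v]
    have "network W J 4 E0 ((\<lambda>_. w0)(1 := v, 2 := w0, 3 := v))"
      using v w0 by (simp add: eval_nat_numeral insert_commute E0_def)
    then have "P 0 (E0, (\<lambda>_. w0)(1 := v, 2 := w0, 3 := v))"
      by (auto simp: P_def E0_def)
    then show "\<exists>s. P 0 s" ..
  next
    fix s n assume "P n s"
    then obtain E l where s: "s = (E, l)" and net: "network W J (n + 4) E l"
      and init: "l 0 = w0" "E \<inter> {..<4} \<times> {..<4} = E0"
      by (cases s) (auto simp: P_def)
    obtain x r where t: "task n = (x, r)" by fastforce
    have "x < n + 4" "\<And>y. r = Inl y \<Longrightarrow> y < n + 4"
      using task_fst_le task_Inl_le t by fastforce+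
    from network_repair[where D = D and r = r, OF net J_sym total this]
    obtain E' l' where step: "network W J (Suc n + 4) E' l'"
      "E' \<inter> {..<n+4} \<times> {..<n+4} = E" "\<forall>z<n+4. l' z = l z"
      "network_step W J D (task n) E l E' l'"
      unfolding t by auto
    have "P (Suc n) (E', l')"
      using step init by (auto simp: P_def)
    moreover have "Q n s (E', l')" using step by (simp add: Q_def s)
    ultimately show "\<exists>s'. P (Suc n) s' \<and> Q n s s'" by blast
  qed
  then obtain f where f: "\<And>n. P n (f n)" "\<And>n. Q n (f n) (f (Suc n))" by blast
  define E l where "E n = fst (f n)" and "l n = snd (f n)" for n
  have net: "network W J (n + 4) (E n) (l n)"
    and init: "l n 0 = w0" "E n \<inter> {..<4} \<times> {..<4} = E0" for n
    using f(1)[of n] by (auto simp: P_def E_def l_def)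
  have E_Suc: "E (Suc n) \<inter> {..<n+4} \<times> {..<n+4} = E n"
    and l_Suc: "z < n + 4 \<Longrightarrow> l (Suc n) z = l n z"
    and step: "network_step W J D (task n) (E n) (l n) (E (Suc n)) (l (Suc n))" for n z
    using f(2)[of n] by (auto simp: Q_def E_def l_def)
  have E_mono: "E m \<subseteq> E n" if "m \<le> n" for m n
  proof (rule lift_Suc_mono_le[OF _ that])
    show "E i \<subseteq> E (Suc i)" for i using E_Suc[of i] by blast
  qed
  have l_stable: "l n z = l m z" if "m \<le> n" "z < m + 4" for m n z
    using that by (induction n rule: dec_induct) (auto simp: l_Suc)
  define EE where "EE = (\<Union>n. E n)"
  \<comment> \<open>Vertex \<open>z\<close> is present at stage \<open>z\<close>, and its label is
    fixed from then on.\<close>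
  define ll where "ll z = l z z" for z
  have ll: "l n z = ll z" if "z < n + 4" for n z
    using that l_stable[of n z z] l_stable[of z n z] unfolding ll_def by (cases "n \<le> z") auto
  have bound: "x < n + 4" "y < n + 4" if "(x, y) \<in> E n" for x y n
    using net[of n] that unfolding network_def by auto
  have "no_4_cycle EE"
    unfolding no_4_cycle_def
  proof (intro allI impI)
    fix a b c d assume "(a, b) \<in> EE \<and> (b, c) \<in> EE \<and> (c, d) \<in> EE \<and> (d, a) \<in> EE"
    then obtain i j k m where
      "(a, b) \<in> E i" "(b, c) \<in> E j" "(c, d) \<in> E k" "(d, a) \<in> E m"
      unfolding EE_def by blast
    \<comment> \<open>The sum serves as an upper bound of the four stages.\<close>
    then have "(a, b) \<in> E (i+j+k+m)" "(b, c) \<in> E (i+j+k+m)" "(c, d) \<in> E (i+j+k+m)"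
      "(d, a) \<in> E (i+j+k+m)"
      using E_mono[of i "i+j+k+m"] E_mono[of j "i+j+k+m"] E_mono[of k "i+j+k+m"]
        E_mono[of m "i+j+k+m"] by auto
    then show "a = c \<or> b = d"
      using net[of "i+j+k+m"] unfolding network_def no_4_cycle_def by blast
  qed
  moreover have "(x, y) \<in> EE O EE" for x y
  proof -
    obtain n where "task n = (x, Inl y)" using task_surj by blast
    then show ?thesis using step[of n] unfolding network_step_def EE_def by auto
  qed
  then have "EE O EE = UNIV" by auto
  moreover have "range ll \<subseteq> W" using net unfolding network_def ll_def by blast
  moreover have "J (ll x) (ll y)" if xy: "(x, y) \<in> EE" for x y
  proof -
    obtain n where n: "(x, y) \<in> E n" using xy unfolding EE_def by blast
    then have "J (l n x) (l n y)" using net[of n] unfolding network_def by blast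
    then show ?thesis using ll bound[OF n] by simp
  qed
  moreover have "\<exists>y. (x, y) \<in> EE \<and> ll y \<in> D k" if w: "\<exists>w\<in>W. J (ll x) w \<and> w \<in> D k" for x k
  proof -
    obtain n where n: "task n = (x, Inr k)" using task_surj by blast
    have "l n x = ll x" using ll task_fst_le[OF n] by simp
    then obtain y where y: "(x, y) \<in> E (Suc n)" "l (Suc n) y \<in> D k"
      using step[of n] n w unfolding network_step_def by auto
    then show ?thesis using ll bound(2)[OF y(1)] unfolding EE_def by auto
  qed
  moreover have "ll 0 = w0" using init unfolding ll_def by blast
  moreover have "EE \<inter> {..<4} \<times> {..<4} = E0" using init(2) unfolding EE_def by blast
  ultimately show ?thesis unfolding E0_def by blast
qed

section \<open>The labelled free plane as a model of the consistent set\<close>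

instance form :: countable by countable_datatype

theorem theorem6p4:
  fixes \<Sigma> :: "form set"
  assumes "consistent logic_8f \<Sigma>"
  shows "\<exists>(X :: point set) I V.
    elliptic_plane X I \<and> nondegenerate X I \<and> model X I V \<and> satisfiable_in X I V \<Sigma>"
proof -
  obtain w0 where w0: "L8f.mcs w0" "\<Sigma> \<subseteq> w0" using L8f.consistent_imp_mcs[OF assms] by blast
  \<comment> \<open>\<open>can8_imp_two_steps\<close> makes this set closed under single steps, and
    \<open>can8_two_steps_trans\<close> gives any two of its points a common neighbour.\<close>
  define W where "W = {w. \<exists>u. can8 w0 u \<and> can8 u w}"
  have closed: "w \<in> W" if "v \<in> W" "can8 v w" for v w
    using that can8_imp_two_steps[OF that(2)] can8_two_steps_trans unfolding W_def by blast
  have "w0 \<in> W" using can8_serial[OF w0(1)] can8_sym unfolding W_def by blast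
  have "\<forall>v\<in>W. \<forall>w\<in>W. \<exists>u\<in>W. can8 v u \<and> can8 u w"
  proof (intro ballI)
    fix v w assume vw: "v \<in> W" "w \<in> W"
    have "\<exists>u. can8 v u \<and> can8 u w"
      using vw can8_sym can8_two_steps_trans unfolding W_def by blast
    then show "\<exists>u\<in>W. can8 v u \<and> can8 u w" using closed vw(1) by blast
  qed
  \<comment> \<open>The index \<open>k\<close> runs through all formulas by countability, so every
    diamond requirement is scheduled.\<close>
  from free_plane[OF symp_can8 this \<open>w0 \<in> W\<close>, of "\<lambda>k. {w. from_nat k \<in> w}"]
  obtain E l where no4: "no_4_cycle E" and total: "E O E = UNIV" and lW: "range l \<subseteq> W"
    and edge: "\<forall>x y. (x, y) \<in> E \<longrightarrow> can8 (l x) (l y)"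
    and diamond: "\<forall>x k. (\<exists>w\<in>W. can8 (l x) w \<and> w \<in> {w. from_nat k \<in> w}) \<longrightarrow>
      (\<exists>y. (x, y) \<in> E \<and> l y \<in> {w. from_nat k \<in> w})"
    and l0: "l 0 = w0"
    and path: "E \<inter> {..<4} \<times> {..<4} = {(0,1), (1,0), (1,2), (2,1), (2,3), (3::nat,2)}"
    by (elim exE conjE) (rule that)
  have lmcs: "L8f.mcs (l x)" for x using lW unfolding W_def can8_def by blast
  \<comment> \<open>Singletons embed the vertices into the prescribed type of points.\<close>
  define pt :: "nat \<Rightarrow> point" where "pt n = {n}" for n
  define I where "I = map_prod pt pt ` E"
  define V where "V p = pt ` {x. Var p \<in> l x}" for p
  have pt_eq: "pt x = pt y \<longleftrightarrow> x = y" for x y by (simp add: pt_def)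
  have I_from: "(pt x, b) \<in> I \<longleftrightarrow> (\<exists>y. b = pt y \<and> (x, y) \<in> E)" for x b
    unfolding I_def by (force simp: pt_eq)
  then have I_iff: "(pt x, pt y) \<in> I \<longleftrightarrow> (x, y) \<in> E" for x y
    by (auto simp: pt_eq)
  \<comment> \<open>The labelling preserves edges but need not reach every canonical successor of a
    label; one witness per diamond formula suffices for the induction.\<close>
  have truth: "true_at I V (pt x) \<phi> \<longleftrightarrow> \<phi> \<in> l x" for x \<phi>
  proof (induction \<phi> arbitrary: x)
    case (Var p)
    show ?case by (auto simp: V_def pt_eq)
  next
    case (Neg \<phi>)
    then show ?case using L8f.mcs_Neg[OF lmcs] by simp
  next
    case (Conj \<phi> \<psi>)
    then show ?case using L8f.mcs_Conj[OF lmcs] by simp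
  next
    case (Box \<phi>)
    have "true_at I V (pt x) (Box \<phi>) \<longleftrightarrow> (\<forall>y. (x, y) \<in> E \<longrightarrow> \<phi> \<in> l y)"
      using Box.IH by (auto simp: I_from)
    also have "\<dots> \<longleftrightarrow> Box \<phi> \<in> l x"
    proof
      assume "Box \<phi> \<in> l x"
      then show "\<forall>y. (x, y) \<in> E \<longrightarrow> \<phi> \<in> l y"
        using edge unfolding can8_def L8f.unbox_def by blast
    next
      assume all: "\<forall>y. (x, y) \<in> E \<longrightarrow> \<phi> \<in> l y"
      show "Box \<phi> \<in> l x"
      proof (rule ccontr)
        assume "Box \<phi> \<notin> l x"
        then obtain w where w: "can8 (l x) w" "Neg \<phi> \<in> w"
          using L8f.mcs_Box[OF lmcs] L8f.mcs_Neg lmcs unfolding can8_def by blast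
        moreover have "w \<in> W" using closed w(1) lW by blast
        ultimately obtain y where "(x, y) \<in> E" "Neg \<phi> \<in> l y"
          using diamond[rule_format, of x "to_nat (Neg \<phi>)"] by auto
        then show False using all L8f.mcs_Neg[OF lmcs] by blast
      qed
    qed
    finally show ?case .
  qed
  have "elliptic_plane (range pt) I"
  proof -
    have "(pt x, pt y) \<in> I O I" for x y
    proof -
      have "(x, y) \<in> E O E" using total by blast
      then show ?thesis using I_iff by blast
    qed
    moreover have "frame (range pt) I" unfolding frame_def I_def by auto
    ultimately show ?thesis
      using no4 unfolding elliptic_plane_def no_4_cycle_def by (auto simp: I_iff pt_eq)
  qed
  moreover have "nondegenerate (range pt) I"
  proof -
    \<comment> \<open>Non-degeneracy is witnessed by the initial path, for which the missing edges
      matter as much as the present ones.\<close>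
    have E: "(x, y) \<in> E \<longleftrightarrow> (x, y) \<in> {(0,1), (1,0), (1,2), (2,1), (2,3), (3::nat,2)}"
      if "x < 4" "y < 4" for x y
      using that path[symmetric] by auto
    have "(pt 0, pt 1) \<in> I \<and> (pt 1, pt 2) \<in> I \<and> (pt 2, pt 3) \<in> I \<and> pt 0 \<noteq> pt 2 \<and>
        pt 1 \<noteq> pt 3 \<and> (pt 0, pt 2) \<notin> I \<and> (pt 1, pt 3) \<notin> I"
      unfolding I_iff pt_eq by (simp add: E)
    then show ?thesis unfolding nondegenerate_def by blast
  qed
  moreover have "model (range pt) I V"
    unfolding model_def frame_def I_def V_def by auto
  moreover have "satisfiable_in (range pt) I V \<Sigma>"
    using w0(2) truth l0 unfolding satisfiable_in_def by blast
  ultimately show ?thesis by blast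
qed

end
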